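(* Let $C_n\square C_m$ be the Cartesian product of the cycle graphs $C_n$ and $C_m$ on $n$ and $m$ vertices, whose vertices are labelled $1,2,\dots,n$ and $1,2,\dots,m$ respectively. 1. If $n$ and $m$ are both even, then each vertex of the eccentric graph $E(C_n\square C_m)$ has degree $1$; in other words, $E(C_n\square C_m)$ is isomorphic to the graph consisting of $\frac{nm}{2}$ copies of the complete graph $K_2$. 2. If $n$ is even and $m$ is odd, then $E(C_n\square C_m)$ is a $2$-regular graph, and consequently is either a cycle or a union of cycles. Moreover, $E(C_n\square C_m)$ consists of $\frac{n}{2}$ cycles of length $2m$, namely $$\Big((i,1),\big(\tfrac{n}{2}+i,2\big),\dots,(i,m),\big(\tfrac{n}{2}+i,1\big),(i,2),\dots,\big(\tfrac{n}{2}+i,m\big)\Big)$$ for $i\in\{1,\dots,\frac{n}{2}\}$.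
   Context: For a connected simple graph $G$, $d_G$ is the graph distance and $e_G(v)=\max\{d_G(u,v):u\in V(G)\}$. A vertex $u$ is eccentric to $v$ if $d_G(u,v)=e_G(v)$. The eccentric graph $E(G)$ is the simple graph on vertex set $V(G)$ in which two vertices $u,v$ are adjacent iff $u$ is eccentric to $v$ or $v$ is eccentric to $u$. The Cartesian product $G_1\square G_2$ has vertex set $V(G_1)\times V(G_2)$, with $(u_1,u_2)$ adjacent to $(v_1,v_2)$ iff either $u_1=v_1$ and $u_2$ is adjacent to $v_2$ in $G_2$, or $u_1$ is adjacent to $v_1$ in $G_1$ and $u_2=v_2$. The labelling of a cycle graph $C_n$ by $1,2,\dots,n$ is the natural one, in order around the cycle. In the displayed cycles, the first coordinate alternates between $i$ and $\frac{n}{2}+i$, while the second coordinate runs through $1,2,\dots,m$ twice.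
   Formalization: The displayed cycles fail for odd m ≥ 5 under the natural labelling (for n=4, m=5, (1,1) and (3,2) are not adjacent); here second coordinate j means the j-th vertex of C_m listed from 1 in steps of (m-1)/2 modulo m, which is the natural order when m=3. Cycles are taken with n, m ≥ 3. *)

theory Defs
  imports Main
begin

record 'a sgraph =
  verts :: "'a set"
  edges :: "'a set set"

definition simple_graph :: "'a sgraph \<Rightarrow> bool" where
  "simple_graph G \<longleftrightarrow> (\<forall>e\<in>edges G. e \<subseteq> verts G \<and> card e = 2)"

definition adj :: "'a sgraph \<Rightarrow> 'a \<Rightarrow> 'a \<Rightarrow> bool" where
  "adj G u v \<longleftrightarrow> {u, v} \<in> edges G"

definition degree :: "'a sgraph \<Rightarrow> 'a \<Rightarrow> nat" where
  "degree G v = card {u \<in> verts G. adj G v u}"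

definition regular :: "nat \<Rightarrow> 'a sgraph \<Rightarrow> bool" where
  "regular k G \<longleftrightarrow> (\<forall>v\<in>verts G. degree G v = k)"

definition isomorphic :: "'a sgraph \<Rightarrow> 'b sgraph \<Rightarrow> bool" where
  "isomorphic G H \<longleftrightarrow> (\<exists>f. bij_betw f (verts G) (verts H) \<and>
     (\<forall>u\<in>verts G. \<forall>v\<in>verts G. adj G u v \<longleftrightarrow> adj H (f u) (f v)))"

text \<open>The relation power \<open>adj G ^^ k\<close> relates the endpoints of walks of length \<open>k\<close>. The distance
  is unspecified for vertices in different components; it is only used in connected graphs.\<close>

definition gdist :: "'a sgraph \<Rightarrow> 'a \<Rightarrow> 'a \<Rightarrow> nat" where
  "gdist G u v = (LEAST k. (adj G ^^ k) u v)"

definition eccentricity :: "'a sgraph \<Rightarrow> 'a \<Rightarrow> nat" where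
  "eccentricity G v = Max {gdist G u v |u. u \<in> verts G}"

definition eccentric_to :: "'a sgraph \<Rightarrow> 'a \<Rightarrow> 'a \<Rightarrow> bool" where
  "eccentric_to G u v \<longleftrightarrow> gdist G u v = eccentricity G v"

definition eccentric_graph :: "'a sgraph \<Rightarrow> 'a sgraph" where
  "eccentric_graph G =
     \<lparr>verts = verts G,
      edges = {{u, v} |u v. u \<in> verts G \<and> v \<in> verts G \<and> u \<noteq> v \<and>
                 (eccentric_to G u v \<or> eccentric_to G v u)}\<rparr>"

definition cartesian_product :: "'a sgraph \<Rightarrow> 'b sgraph \<Rightarrow> ('a \<times> 'b) sgraph"
    (infixr "\<box>" 70) where
  "G \<box> H =
     \<lparr>verts = verts G \<times> verts H,
      edges = {{(u1, u2), (v1, v2)} |u1 u2 v1 v2.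
                 u1 \<in> verts G \<and> u2 \<in> verts H \<and> v1 \<in> verts G \<and> v2 \<in> verts H \<and>
                 (u1 = v1 \<and> adj H u2 v2 \<or> adj G u1 v1 \<and> u2 = v2)}\<rparr>"

text \<open>This is the cycle on \<open>1, \<dots>, n\<close> for \<open>n \<ge> 3\<close> only.\<close>

definition cycle_graph :: "nat \<Rightarrow> nat sgraph" where
  "cycle_graph n = \<lparr>verts = {1..n}, edges = insert {n, 1} {{k, k + 1} |k. 1 \<le> k \<and> k < n}\<rparr>"

definition complete_graph :: "nat \<Rightarrow> nat sgraph" where
  "complete_graph n = \<lparr>verts = {1..n}, edges = {{u, v} |u v. u \<in> {1..n} \<and> v \<in> {1..n} \<and> u \<noteq> v}\<rparr>"

definition copies :: "nat \<Rightarrow> 'a sgraph \<Rightarrow> (nat \<times> 'a) sgraph" where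
  "copies k G = \<lparr>verts = {1..k} \<times> verts G, edges = {Pair c ` e |c e. c \<in> {1..k} \<and> e \<in> edges G}\<rparr>"

text \<open>A cycle is given by the list of its vertices in cyclic order.\<close>

definition cyclic_edges :: "'a list \<Rightarrow> 'a set set" where
  "cyclic_edges p = {{p ! k, p ! (Suc k mod length p)} |k. k < length p}"

definition is_cycle :: "'a sgraph \<Rightarrow> 'a list \<Rightarrow> bool" where
  "is_cycle G p \<longleftrightarrow> 3 \<le> length p \<and> distinct p \<and> set p \<subseteq> verts G \<and> cyclic_edges p \<subseteq> edges G"

text \<open>\<open>G\<close> is the union of the pairwise vertex-disjoint cycles in \<open>C\<close>.\<close>

definition consists_of_cycles :: "'a sgraph \<Rightarrow> 'a list set \<Rightarrow> bool" where
  "consists_of_cycles G C \<longleftrightarrow>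
     (\<forall>p\<in>C. is_cycle G p) \<and>
     (\<forall>p\<in>C. \<forall>q\<in>C. p \<noteq> q \<longrightarrow> set p \<inter> set q = {}) \<and>
     verts G = (\<Union>p\<in>C. set p) \<and>
     edges G = (\<Union>p\<in>C. cyclic_edges p)"

text \<open>The cycle \<open>(i, l 1), (n/2 + i, l 2), \<dots>, (i, l m), (n/2 + i, l 1), (i, l 2), \<dots>, (n/2 + i, l m)\<close>
  for odd \<open>m\<close>, where \<open>l j\<close> is the vertex of the second factor that is listed as number \<open>j\<close>.\<close>

definition alternating_cycle :: "nat \<Rightarrow> nat \<Rightarrow> (nat \<Rightarrow> nat) \<Rightarrow> nat \<Rightarrow> (nat \<times> nat) list" where
  "alternating_cycle n m l i =
     map (\<lambda>k. (if even k then i else n div 2 + i, l (k mod m + 1))) [0..<2 * m]"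

text \<open>For odd \<open>m\<close> the vertices eccentric to \<open>x\<close> in the \<open>m\<close>-cycle are \<open>x \<plusminus> (m - 1)/2\<close> modulo \<open>m\<close>.
  Neighbours in an alternating cycle of the eccentric graph must therefore have second coordinates
  that differ by \<open>(m - 1)/2\<close>, not by 1, and the vertices \<open>1, \<dots>, m\<close> have to be listed
  in steps of \<open>(m - 1)/2\<close>, starting from 1. This is the order \<open>1, 2, \<dots>, m\<close> around the cycle
  if and only if \<open>m = 3\<close>; the cycles with \<open>l j = j\<close> are not contained in the
  eccentric graph when \<open>m \<ge> 5\<close>.\<close>

definition ecc_label :: "nat \<Rightarrow> nat \<Rightarrow> nat" where
  "ecc_label m j = ((j - 1) * ((m - 1) div 2)) mod m + 1"

lemma simple_graph_cycle_graph: "n \<ge> 3 \<Longrightarrow> simple_graph (cycle_graph n)"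
  by (auto simp: simple_graph_def cycle_graph_def)

lemma simple_graph_cartesian_product:
  "simple_graph G \<Longrightarrow> simple_graph H \<Longrightarrow> simple_graph (G \<box> H)"
  by (fastforce simp: simple_graph_def cartesian_product_def adj_def card_insert_if)

lemma simple_graph_eccentric_graph: "simple_graph (eccentric_graph G)"
  by (auto simp: simple_graph_def eccentric_graph_def)

lemma ecc_label_3: "j \<in> {1..3} \<Longrightarrow> ecc_label 3 j = j"
  by (auto simp: ecc_label_def)

end

(*
  The distance in C_n \<box> C_m is the sum of the distances in the two factors, so a vertex is
  eccentric to another one if and only if both coordinates are: the eccentric graph of the product
  is the direct product of the eccentric graphs of the factors. In an even cycle each vertex has
  exactly one eccentric vertex, its antipode, and in an odd cycle it has exactly two. This gives the
  degrees. For even n and odd m the alternating cycles are pairwise disjoint cycles of the 2-regular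
  eccentric graph; they have n/2 * 2m = nm vertices in total, hence they exhaust it.
*)
theory Submission
  imports Defs
begin

section \<open>Distances in cycles and products\<close>

lemma adj_verts:
  assumes "simple_graph G" "adj G x y"
  shows "x \<in> verts G" "y \<in> verts G" "x \<noteq> y"
  using assms by (force simp: simple_graph_def adj_def)+

lemma adj_commute: "adj G x y \<longleftrightarrow> adj G y x"
  by (simp add: adj_def insert_commute)

text \<open>Local conditions that pin down the distance from each source \<open>u\<close>, so that a
  closed formula can be verified edge by edge without considering shortest walks.\<close>

definition distance_function :: "'a sgraph \<Rightarrow> ('a \<Rightarrow> 'a \<Rightarrow> nat) \<Rightarrow> bool" where
  "distance_function G d \<longleftrightarrow>
     (\<forall>u\<in>verts G. d u u = 0) \<and>
     (\<forall>u\<in>verts G. \<forall>x y. adj G x y \<longrightarrow> d u y \<le> Suc (d u x)) \<and>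
     (\<forall>u\<in>verts G. \<forall>v\<in>verts G. u \<noteq> v \<longrightarrow> (\<exists>x. adj G x v \<and> d u v = Suc (d u x)))"

lemma distance_function_predecessor:
  assumes "distance_function G d" "u \<in> verts G" "v \<in> verts G" "u \<noteq> v"
  obtains x where "adj G x v" "d u v = Suc (d u x)"
  using assms unfolding distance_function_def by blast

text \<open>An edge raises \<open>d u\<close> by at most 1, so a walk of length \<open>k\<close>
  from \<open>u\<close> ends at a vertex of value at most \<open>k\<close>. Conversely, repeated
  passage to a predecessor reaches \<open>u\<close> after exactly \<open>d u w\<close> edges. Hence
  \<open>d u v\<close> is the least length of a walk.\<close>

lemma gdist_eq:
  assumes G: "simple_graph G" and d: "distance_function G d"
    and u: "u \<in> verts G" and v: "v \<in> verts G"
  shows "gdist G u v = d u v"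
proof -
  have lower: "d u w \<le> k" if "(adj G ^^ k) u w" for k w
    using that
  proof (induction k arbitrary: w)
    case 0
    then show ?case using d u by (auto simp: distance_function_def)
  next
    case (Suc k)
    then obtain x where x: "(adj G ^^ k) u x" "adj G x w" by (auto elim: relpowp_Suc_E)
    have "d u w \<le> Suc (d u x)" using d u x(2) by (auto simp: distance_function_def)
    also have "\<dots> \<le> Suc k" using Suc.IH[OF x(1)] by simp
    finally show ?case .
  qed
  have walk: "(adj G ^^ k) u w" if "w \<in> verts G" "d u w = k" for k w
    using that
  proof (induction k arbitrary: w)
    case 0
    then have "u = w" using d u unfolding distance_function_def by force
    then show ?case by simp
  next
    case (Suc k)
    then have "u \<noteq> w" using d u by (auto simp: distance_function_def)
    then obtain x where x: "adj G x w" "d u w = Suc (d u x)"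
      using distance_function_predecessor[OF d u Suc.prems(1)] by blast
    then have "(adj G ^^ k) u x" using Suc adj_verts[OF G x(1)] by simp
    then show ?case using x(1) by (rule relpowp_Suc_I)
  qed
  show ?thesis
    unfolding gdist_def by (rule Least_equality) (use lower walk v in auto)
qed

section \<open>Distances in a Cartesian product\<close>

lemma verts_cartesian_product [simp]: "verts (G \<box> H) = verts G \<times> verts H"
  by (simp add: cartesian_product_def)

lemma adj_cartesian_product:
  assumes "simple_graph G" "simple_graph H"
  shows "adj (G \<box> H) x y \<longleftrightarrow> x \<in> verts G \<times> verts H \<and> y \<in> verts G \<times> verts H \<and>
    (fst x = fst y \<and> adj H (snd x) (snd y) \<or> adj G (fst x) (fst y) \<and> snd x = snd y)"
  unfolding adj_def[of "G \<box> H"] unfolding cartesian_product_def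
  by (cases x; cases y) (auto simp: doubleton_eq_iff adj_commute)

text \<open>An edge of the product moves in only one coordinate, so the sum grows by at most 1. A
  predecessor of \<open>v\<close> arises by moving in a coordinate where \<open>u\<close> and
  \<open>v\<close> differ and keeping the other coordinate of \<open>v\<close>.\<close>

lemma distance_function_cartesian_product:
  assumes G: "simple_graph G" "distance_function G d"
    and H: "simple_graph H" "distance_function H d'"
  shows "distance_function (G \<box> H) (\<lambda>x y. d (fst x) (fst y) + d' (snd x) (snd y))"
  unfolding distance_function_def
proof (intro conjI ballI allI impI)
  fix u assume "u \<in> verts (G \<box> H)"
  then show "d (fst u) (fst u) + d' (snd u) (snd u) = 0"
    using G(2) H(2) by (auto simp: distance_function_def)
next
  fix u x y assume "u \<in> verts (G \<box> H)" "adj (G \<box> H) x y"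
  then show "d (fst u) (fst y) + d' (snd u) (snd y) \<le> Suc (d (fst u) (fst x) + d' (snd u) (snd x))"
    using G(2) H(2) by (force simp: distance_function_def adj_cartesian_product[OF G(1) H(1)])
next
  fix u v assume u: "u \<in> verts (G \<box> H)" and v: "v \<in> verts (G \<box> H)" and "u \<noteq> v"
  then consider "fst u \<noteq> fst v" | "snd u \<noteq> snd v" by (auto simp: prod_eq_iff)
  then show "\<exists>x. adj (G \<box> H) x v \<and>
    d (fst u) (fst v) + d' (snd u) (snd v) = Suc (d (fst u) (fst x) + d' (snd u) (snd x))"
  proof cases
    case 1
    then obtain x where x: "adj G x (fst v)" "d (fst u) (fst v) = Suc (d (fst u) x)"
      using distance_function_predecessor[OF G(2), of "fst u" "fst v"] u v 1 by (auto simp: mem_Times_iff)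
    then have "adj (G \<box> H) (x, snd v) v"
      using v adj_verts[OF G(1) x(1)] by (auto simp: adj_cartesian_product[OF G(1) H(1)])
    then show ?thesis using x(2) by (intro exI[of _ "(x, snd v)"]) simp
  next
    case 2
    then obtain x where x: "adj H x (snd v)" "d' (snd u) (snd v) = Suc (d' (snd u) x)"
      using distance_function_predecessor[OF H(2), of "snd u" "snd v"] u v 2 by (auto simp: mem_Times_iff)
    then have "adj (G \<box> H) (fst v, x) v"
      using v adj_verts[OF H(1) x(1)] by (auto simp: adj_cartesian_product[OF G(1) H(1)])
    then show ?thesis using x(2) by (intro exI[of _ "(fst v, x)"]) simp
  qed
qed

section \<open>Distances around a cycle: the length of the shorter arc\<close>

definition cycle_dist :: "nat \<Rightarrow> nat \<Rightarrow> nat \<Rightarrow> nat" where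
  "cycle_dist n x y = (let k = max x y - min x y in min k (n - k))"

lemma cycle_dist_commute: "cycle_dist n x y = cycle_dist n y x"
  by (simp add: cycle_dist_def max.commute min.commute)

lemma cycle_dist_le: "cycle_dist n x y \<le> n div 2"
  unfolding cycle_dist_def Let_def by linarith

lemma verts_cycle_graph [simp]: "verts (cycle_graph n) = {1..n}"
  by (simp add: cycle_graph_def)

lemma adj_cycle_graph:
  "adj (cycle_graph n) x y \<longleftrightarrow> {x, y} = {1, n} \<or>
     x \<in> {1..n} \<and> y \<in> {1..n} \<and> (y = Suc x \<or> x = Suc y)"
  by (auto simp: adj_def cycle_graph_def doubleton_eq_iff)

text \<open>The maximum minus the minimum serves as an absolute difference, since subtraction of
  naturals truncates. Once the order of the arguments is known, only linear arithmetic
  remains.\<close>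

lemma cycle_dist_of_le: "x \<le> y \<Longrightarrow> cycle_dist n x y = min (y - x) (n - (y - x))"
  by (simp add: cycle_dist_def max_def min_def)

lemma cycle_dist_of_ge: "y \<le> x \<Longrightarrow> cycle_dist n x y = min (x - y) (n - (x - y))"
  by (simp add: cycle_dist_def max_def min_def)

lemma cycle_dist_Suc:
  assumes "Suc x \<le> n" "u \<le> n"
  shows "cycle_dist n u (Suc x) \<le> Suc (cycle_dist n u x)"
    and "cycle_dist n u x \<le> Suc (cycle_dist n u (Suc x))"
  by (cases "u \<le> x"; use assms in \<open>simp add: cycle_dist_of_le cycle_dist_of_ge, linarith?\<close>)+

text \<open>This is the bound for the closing edge between \<open>n\<close> and 1; all other edges
  join consecutive numbers.\<close>

lemma cycle_dist_1_n:
  assumes "1 \<le> u" "u \<le> n"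
  shows "cycle_dist n u 1 \<le> Suc (cycle_dist n u n)"
    and "cycle_dist n u n \<le> Suc (cycle_dist n u 1)"
  using assms cycle_dist_of_ge[of 1 u n] cycle_dist_of_le[of u n n] by linarith+

text \<open>The neighbour of \<open>v\<close> on a shorter arc towards \<open>u\<close> is one step
  closer. If twice the difference of the labels is at most \<open>n\<close>, that arc stays between
  the two labels; otherwise it leaves \<open>v\<close> in the other direction and uses the closing
  edge.\<close>

lemma cycle_dist_predecessor:
  assumes "u \<in> {1..n}" "v \<in> {1..n}" "u \<noteq> v"
  shows "cycle_dist n u v = Suc (cycle_dist n u (if v = 1 then n else v - 1)) \<or>
    cycle_dist n u v = Suc (cycle_dist n u (if v = n then 1 else Suc v))"
proof -
  have b: "1 \<le> u" "u \<le> n" "1 \<le> v" "v \<le> n" using assms by auto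
  show ?thesis
  proof (cases "u < v")
    case True
    show ?thesis
    proof (cases "2 * (v - u) \<le> n")
      case True
      then have "cycle_dist n u v = Suc (cycle_dist n u (v - 1))"
        using b \<open>u < v\<close> cycle_dist_of_le[of u v n] cycle_dist_of_le[of u "v - 1" n] by linarith
      then show ?thesis using \<open>u < v\<close> b by simp
    next
      case False
      \<comment> \<open>The shorter arc goes upwards from \<open>v\<close>; only at
        \<open>v = n\<close> does its first step already wrap around to 1.\<close>
      then have "cycle_dist n u v = Suc (cycle_dist n u (if v = n then 1 else Suc v))"
      proof (cases "v = n")
        case True
        then show ?thesis
          using False b cycle_dist_of_le[of u v n] cycle_dist_of_ge[of 1 u n] by simp
      next
        case False
        have "cycle_dist n u v = n - (v - u)"
          using \<open>\<not> 2 * (v - u) \<le> n\<close> \<open>u < v\<close> by (simp add: cycle_dist_of_le)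
        moreover have "cycle_dist n u (Suc v) = n - (Suc v - u)"
          using \<open>\<not> 2 * (v - u) \<le> n\<close> \<open>u < v\<close> by (simp add: cycle_dist_of_le)
        ultimately show ?thesis using False b \<open>u < v\<close> by simp
      qed
      then show ?thesis by blast
    qed
  next
    case False
    then have "v < u" using assms by simp
    show ?thesis
    proof (cases "2 * (u - v) \<le> n")
      case True
      then have "cycle_dist n u v = Suc (cycle_dist n u (Suc v))"
        using b \<open>v < u\<close> cycle_dist_of_ge[of v u n] cycle_dist_of_ge[of "Suc v" u n] by linarith
      then show ?thesis using \<open>v < u\<close> b by simp
    next
      case False
      then have "cycle_dist n u v = Suc (cycle_dist n u (if v = 1 then n else v - 1))"
      proof (cases "v = 1")
        case True
        then show ?thesis
          using False b cycle_dist_of_ge[of v u n] cycle_dist_of_le[of u n n] by simp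
      next
        case False
        have "cycle_dist n u v = n - (u - v)"
          using \<open>\<not> 2 * (u - v) \<le> n\<close> \<open>v < u\<close> by (simp add: cycle_dist_of_ge)
        moreover have "cycle_dist n u (v - 1) = n - (u - (v - 1))"
          using \<open>\<not> 2 * (u - v) \<le> n\<close> \<open>v < u\<close> by (simp add: cycle_dist_of_ge)
        ultimately show ?thesis using False b \<open>v < u\<close> by simp
      qed
      then show ?thesis by blast
    qed
  qed
qed

lemma distance_function_cycle_graph:
  assumes "n \<ge> 3"
  shows "distance_function (cycle_graph n) (cycle_dist n)"
  unfolding distance_function_def
proof (intro conjI ballI allI impI)
  fix u show "cycle_dist n u u = 0" by (simp add: cycle_dist_def)
next
  fix u x y assume "u \<in> verts (cycle_graph n)" "adj (cycle_graph n) x y"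
  then show "cycle_dist n u y \<le> Suc (cycle_dist n u x)"
    using cycle_dist_Suc[of x n u] cycle_dist_Suc[of y n u] cycle_dist_1_n[of u n]
    by (auto simp: adj_cycle_graph doubleton_eq_iff)
next
  fix u v assume uv: "u \<in> verts (cycle_graph n)" "v \<in> verts (cycle_graph n)" "u \<noteq> v"
  let ?pred = "if v = 1 then n else v - 1" and ?succ = "if v = n then 1 else Suc v"
  have adj: "adj (cycle_graph n) ?pred v" "adj (cycle_graph n) ?succ v"
    using uv by (auto simp: adj_cycle_graph)
  have "cycle_dist n u v = Suc (cycle_dist n u ?pred) \<or> cycle_dist n u v = Suc (cycle_dist n u ?succ)"
    using cycle_dist_predecessor uv by simp
  then show "\<exists>x. adj (cycle_graph n) x v \<and> cycle_dist n u v = Suc (cycle_dist n u x)"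
    using adj by blast
qed

section \<open>The eccentric graph of the product of two cycles\<close>

lemma min_diff_eq_half_iff:
  fixes k n :: nat
  assumes "k \<le> n"
  shows "min k (n - k) = n div 2 \<longleftrightarrow> k = n div 2 \<or> k = n - n div 2"
proof
  assume "min k (n - k) = n div 2"
  then show "k = n div 2 \<or> k = n - n div 2" using assms unfolding min_def by (auto split: if_splits)
next
  have "n div 2 \<le> n - n div 2" by linarith
  moreover assume "k = n div 2 \<or> k = n - n div 2"
  ultimately show "min k (n - k) = n div 2" using assms by auto
qed

text \<open>One of the two arcs has length \<open>n div 2\<close> and the other
  \<open>n - n div 2\<close>; together with the order of \<open>x\<close> and \<open>y\<close> this
  gives four cases. The two lengths coincide for even \<open>n\<close> and differ by 1 for odd
  \<open>n\<close>, which is the source of one versus two eccentric vertices.\<close>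

lemma cycle_dist_eq_half_iff:
  assumes "x \<le> n" "y \<le> n"
  shows "cycle_dist n x y = n div 2 \<longleftrightarrow>
    y = x + n div 2 \<or> y = x + (n - n div 2) \<or> x = y + n div 2 \<or> x = y + (n - n div 2)"
proof (cases "x \<le> y")
  case True
  then have "min (y - x) (n - (y - x)) = n div 2 \<longleftrightarrow> y = x + n div 2 \<or> y = x + (n - n div 2)"
    using assms min_diff_eq_half_iff[of "y - x" n] by auto
  \<comment> \<open>With \<open>x \<le> y\<close> the reversed equations force the added amount to
    be 0, so they are absorbed by the first two.\<close>
  moreover have "y = x + n div 2" if "x = y + n div 2" using that True by simp
  moreover have "y = x + (n - n div 2)" if "x = y + (n - n div 2)" using that True by simp
  ultimately show ?thesis using True by (auto simp only: cycle_dist_of_le)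
next
  case False
  then have "y \<le> x" by simp
  moreover have "min (x - y) (n - (x - y)) = n div 2 \<longleftrightarrow> x = y + n div 2 \<or> x = y + (n - n div 2)"
    using assms \<open>y \<le> x\<close> min_diff_eq_half_iff[of "x - y" n] by auto
  moreover have "y \<noteq> x + n div 2" "y \<noteq> x + (n - n div 2)" using False by auto
  ultimately show ?thesis by (simp add: cycle_dist_of_ge)
qed

lemma cycle_dist_eq_even_iff:
  assumes "even n" "x \<in> {1..n}" "y \<in> {1..n}"
  shows "cycle_dist n x y = n div 2 \<longleftrightarrow> y = (if x \<le> n div 2 then x + n div 2 else x - n div 2)"
proof -
  obtain h where h: "n = 2 * h" using \<open>even n\<close> by (elim evenE)
  show ?thesis
    using assms(2,3) cycle_dist_eq_half_iff[of x n y] h by auto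
qed

lemma card_eccentric_even:
  assumes "even n" "x \<in> {1..n}"
  shows "card {y \<in> {1..n}. cycle_dist n x y = n div 2} = 1"
proof -
  let ?a = "if x \<le> n div 2 then x + n div 2 else x - n div 2"
  have "?a \<in> {1..n}" using assms by (auto elim!: evenE)
  then have "{y \<in> {1..n}. cycle_dist n x y = n div 2} = {?a}"
    using cycle_dist_eq_even_iff[OF assms] by blast
  then show ?thesis by simp
qed

lemma card_eccentric_odd:
  assumes "odd n" "n \<ge> 3" "x \<in> {1..n}"
  shows "card {y \<in> {1..n}. cycle_dist n x y = n div 2} = 2"
proof -
  obtain h where n: "n = 2 * h + 1" using \<open>odd n\<close> by (elim oddE)
  \<comment> \<open>The two candidates are \<open>x + h\<close> and \<open>x + h + 1\<close>,
    reduced modulo \<open>n\<close> to labels in \<open>{1..n}\<close>.\<close>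
  define a where "a = (if x \<le> h + 1 then x + h else x - h - 1)"
  define b where "b = (if x \<le> h then x + h + 1 else x - h)"
  have "{y \<in> {1..n}. cycle_dist n x y = n div 2} = {a, b}" "a \<noteq> b"
  proof -
    have "cycle_dist n x y = n div 2 \<longleftrightarrow> y = a \<or> y = b" if "y \<in> {1..n}" for y
      using assms that n cycle_dist_eq_half_iff[of x n y] by (auto simp: a_def b_def)
    moreover have "a \<in> {1..n}" "b \<in> {1..n}" using assms n by (auto simp: a_def b_def)
    ultimately show "{y \<in> {1..n}. cycle_dist n x y = n div 2} = {a, b}" by blast
    show "a \<noteq> b" using assms n by (auto simp: a_def b_def)
  qed
  then show ?thesis by simp
qed

text \<open>Shows that the upper bound of \<open>cycle_dist_le\<close> is sharp at every vertex, so
  that \<open>n div 2\<close> is the eccentricity of each vertex of the cycle.\<close>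

lemma cycle_dist_attained:
  assumes "n \<ge> 3" "x \<in> {1..n}"
  obtains y where "y \<in> {1..n}" "cycle_dist n y x = n div 2"
proof -
  have "card {y \<in> {1..n}. cycle_dist n x y = n div 2} \<noteq> 0"
    using assms card_eccentric_even card_eccentric_odd by (cases "even n") auto
  then have "{y \<in> {1..n}. cycle_dist n x y = n div 2} \<noteq> {}" by (metis card.empty)
  then show ?thesis using that by (auto simp: cycle_dist_commute)
qed

section \<open>Adjacency and degrees in the eccentric graph of the product\<close>

context
  fixes n m :: nat
  assumes n: "n \<ge> 3" and m: "m \<ge> 3"
begin

abbreviation (input) "E \<equiv> eccentric_graph (cycle_graph n \<box> cycle_graph m)"

lemma verts_E: "verts E = {1..n} \<times> {1..m}"
  by (simp add: eccentric_graph_def)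

lemma gdist_product:
  assumes "u \<in> {1..n} \<times> {1..m}" "v \<in> {1..n} \<times> {1..m}"
  shows "gdist (cycle_graph n \<box> cycle_graph m) u v =
    cycle_dist n (fst u) (fst v) + cycle_dist m (snd u) (snd v)"
proof -
  note simple = simple_graph_cycle_graph[OF n] simple_graph_cycle_graph[OF m]
  show ?thesis
    using gdist_eq[OF simple_graph_cartesian_product[OF simple]
        distance_function_cartesian_product[OF simple(1) distance_function_cycle_graph[OF n]
          simple(2) distance_function_cycle_graph[OF m]]] assms
    by simp
qed

text \<open>Both summands of the distance can be maximized simultaneously, because the two
  coordinates of \<open>u\<close> are chosen independently.\<close>

lemma eccentricity_product:
  assumes v: "v \<in> {1..n} \<times> {1..m}"
  shows "eccentricity (cycle_graph n \<box> cycle_graph m) v = n div 2 + m div 2"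
proof -
  obtain x where x: "x \<in> {1..n}" "cycle_dist n x (fst v) = n div 2"
    using cycle_dist_attained[OF n] v by force
  obtain y where y: "y \<in> {1..m}" "cycle_dist m y (snd v) = m div 2"
    using cycle_dist_attained[OF m] v by force
  let ?D = "{gdist (cycle_graph n \<box> cycle_graph m) u v |u. u \<in> {1..n} \<times> {1..m}}"
  have D: "?D = (\<lambda>u. cycle_dist n (fst u) (fst v) + cycle_dist m (snd u) (snd v)) ` ({1..n} \<times> {1..m})"
    unfolding Setcompr_eq_image by (rule image_cong) (use v gdist_product in auto)
  have "Max ?D = n div 2 + m div 2"
    unfolding D
  proof (rule Max_eqI)
    show "n div 2 + m div 2 \<in> (\<lambda>u. cycle_dist n (fst u) (fst v) + cycle_dist m (snd u) (snd v)) `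
      ({1..n} \<times> {1..m})"
      using x y by (intro image_eqI[of _ _ "(x, y)"]) auto
  qed (auto intro: add_mono cycle_dist_le)
  then show ?thesis by (simp add: eccentricity_def)
qed

text \<open>Two terms bounded by \<open>n div 2\<close> and \<open>m div 2\<close> can add up to the
  sum of these bounds only if each attains its own.\<close>

lemma eccentric_to_product_iff:
  assumes "u \<in> {1..n} \<times> {1..m}" "v \<in> {1..n} \<times> {1..m}"
  shows "eccentric_to (cycle_graph n \<box> cycle_graph m) u v \<longleftrightarrow>
    cycle_dist n (fst u) (fst v) = n div 2 \<and> cycle_dist m (snd u) (snd v) = m div 2"
  using cycle_dist_le[of n "fst u" "fst v"] cycle_dist_le[of m "snd u" "snd v"] assms
  by (auto simp: eccentric_to_def gdist_product eccentricity_product)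

text \<open>Removes the choice of representatives \<open>x\<close>, \<open>y\<close> of an unordered
  pair, as well as the two-sided disjunction in the definition of the eccentric graph.\<close>

lemma ex_edge:
  assumes "\<And>x y. R x y \<longleftrightarrow> R y x" "\<And>x. \<not> R x x"
  shows "(\<exists>x y. {u, v} = {x, y} \<and> x \<noteq> y \<and> (R x y \<or> R y x)) \<longleftrightarrow> R u v"
  unfolding doubleton_eq_iff using assms by blast

text \<open>All vertices of the product have the same eccentricity and distance is symmetric, so
  being eccentric is a symmetric relation here and one direction suffices.\<close>

lemma adj_E:
  "adj E u v \<longleftrightarrow> u \<in> {1..n} \<times> {1..m} \<and> v \<in> {1..n} \<times> {1..m} \<and>
     cycle_dist n (fst u) (fst v) = n div 2 \<and> cycle_dist m (snd u) (snd v) = m div 2"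
  (is "_ \<longleftrightarrow> ?R u v")
proof -
  have sym: "?R u v \<longleftrightarrow> ?R v u" for u v by (auto simp: cycle_dist_commute)
  \<comment> \<open>A vertex has distance 0 to itself, whereas \<open>n div 2\<close> is
    positive.\<close>
  have irrefl: "\<not> ?R u u" for u using n by (auto simp: cycle_dist_def)
  have ecc: "x \<in> {1..n} \<times> {1..m} \<and> y \<in> {1..n} \<times> {1..m} \<and> x \<noteq> y \<and>
      (eccentric_to (cycle_graph n \<box> cycle_graph m) x y \<or>
       eccentric_to (cycle_graph n \<box> cycle_graph m) y x) \<longleftrightarrow> x \<noteq> y \<and> (?R x y \<or> ?R y x)" for x y
    using eccentric_to_product_iff[of x y] eccentric_to_product_iff[of y x] by argo
  have "adj E u v \<longleftrightarrow> (\<exists>x y. {u, v} = {x, y} \<and>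
      x \<in> {1..n} \<times> {1..m} \<and> y \<in> {1..n} \<times> {1..m} \<and> x \<noteq> y \<and>
      (eccentric_to (cycle_graph n \<box> cycle_graph m) x y \<or>
       eccentric_to (cycle_graph n \<box> cycle_graph m) y x))"
    by (simp only: adj_def eccentric_graph_def sgraph.simps mem_Collect_eq
        verts_cartesian_product verts_cycle_graph)
  also have "\<dots> \<longleftrightarrow> (\<exists>x y. {u, v} = {x, y} \<and> x \<noteq> y \<and> (?R x y \<or> ?R y x))"
    by (simp only: ecc)
  also have "\<dots> \<longleftrightarrow> ?R u v" by (rule ex_edge[of ?R, OF sym irrefl])
  finally show ?thesis .
qed

text \<open>Adjacency constrains the two coordinates separately, so a neighbourhood is a Cartesian
  product of sets and degrees multiply.\<close>

lemma degree_E: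
  assumes "v \<in> {1..n} \<times> {1..m}"
  shows "degree E v = card {x \<in> {1..n}. cycle_dist n (fst v) x = n div 2} *
    card {y \<in> {1..m}. cycle_dist m (snd v) y = m div 2}"
proof -
  have "{u \<in> verts E. adj E v u} = {x \<in> {1..n}. cycle_dist n (fst v) x = n div 2} \<times>
    {y \<in> {1..m}. cycle_dist m (snd v) y = m div 2}"
    using assms by (auto simp: adj_E verts_E)
  then show ?thesis by (simp add: degree_def card_cartesian_product)
qed

lemma degree_E_even_even:
  assumes "even n" "even m" "v \<in> verts E"
  shows "degree E v = 1"
proof -
  have v: "v \<in> {1..n} \<times> {1..m}" using assms(3) by (simp only: verts_E)
  then have "fst v \<in> {1..n}" "snd v \<in> {1..m}" by (simp_all only: mem_Times_iff)
  then show ?thesis using assms v by (simp only: degree_E card_eccentric_even)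
qed

lemma regular_E_even_odd:
  assumes "even n" "odd m"
  shows "regular 2 E"
  unfolding regular_def verts_E
proof
  fix v assume v: "v \<in> {1..n} \<times> {1..m}"
  then have "fst v \<in> {1..n}" "snd v \<in> {1..m}" by (simp_all only: mem_Times_iff)
  then show "degree E v = 2"
    using assms(1) v
    by (simp only: degree_E card_eccentric_even card_eccentric_odd[OF \<open>odd m\<close> m] mult_1)
qed

end

section \<open>Perfect matchings\<close>

lemma edges_copies_complete_graph_2:
  "edges (copies k (complete_graph 2)) = {{(c, 1), (c, 2)} |c. c \<in> {1..k}}"
proof -
  have "u \<in> {1..2} \<and> v \<in> {1..2} \<and> u \<noteq> v \<longleftrightarrow> {u, v} = {1, 2}" for u v :: nat
    by (auto simp: doubleton_eq_iff)
  then have "edges (complete_graph 2) = {{1, 2}}"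
    unfolding complete_graph_def by auto
  then show ?thesis unfolding copies_def by auto
qed

lemma adj_copies_complete_graph_2:
  "adj (copies k (complete_graph 2)) x y \<longleftrightarrow>
     fst x = fst y \<and> fst x \<in> {1..k} \<and> {snd x, snd y} = {1, 2}"
  unfolding adj_def edges_copies_complete_graph_2
  by (cases x; cases y) (auto simp: doubleton_eq_iff)

text \<open>The graph is a perfect matching between \<open>A\<close> and \<open>B\<close>, encoded
  by the map \<open>s\<close> from each vertex of \<open>B\<close> to its partner. An enumeration
  \<open>g\<close> of \<open>A\<close> numbers the copies; the end in \<open>A\<close> becomes
  vertex 1 of its copy and the end in \<open>B\<close> vertex 2.\<close>

lemma isomorphic_copies_complete_graph_2:
  assumes V: "verts G = A \<union> B" "A \<inter> B = {}" and A: "finite A" "card A = k"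
    and s: "bij_betw s B A"
    and adj: "\<And>u v. u \<in> verts G \<Longrightarrow> v \<in> verts G \<Longrightarrow>
      adj G u v \<longleftrightarrow> u \<in> A \<and> v \<in> B \<and> u = s v \<or> u \<in> B \<and> v \<in> A \<and> v = s u"
  shows "isomorphic G (copies k (complete_graph 2))"
proof -
  obtain g where g: "bij_betw g A {1..k}"
    using A ex_bij_betw_nat_finite_1 bij_betw_inv by metis
  define f where "f v = (if v \<in> A then (g v, 1 :: nat) else (g (s v), 2))" for v
  have gs: "bij_betw (g \<circ> s) B {1..k}" using s g by (rule bij_betw_trans)
  have vK: "verts (copies k (complete_graph 2)) = {1..k} \<times> {1} \<union> {1..k} \<times> {2}"
    by (auto simp: copies_def complete_graph_def)
  have fA: "f x = (g x, 1)" if "x \<in> A" for x using that by (simp add: f_def)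
  have fB: "f x = (g (s x), 2)" if "x \<in> B" for x using that V(2) by (auto simp: f_def)
  have pair: "bij_betw (\<lambda>x. (x, c)) {1..k} ({1..k} \<times> {c})" for c :: nat
    by (auto simp: bij_betw_def inj_on_def)
  have "bij_betw f A ({1..k} \<times> {1})"
    using bij_betw_trans[OF g pair[of 1]] bij_betw_cong[of A f "(\<lambda>x. (x, 1)) \<circ> g"] fA by simp
  moreover have "bij_betw f B ({1..k} \<times> {2})"
    using bij_betw_trans[OF gs pair[of 2]] bij_betw_cong[of B f "(\<lambda>x. (x, 2)) \<circ> (g \<circ> s)"] fB by simp
  ultimately have bij: "bij_betw f (verts G) (verts (copies k (complete_graph 2)))"
    unfolding V(1) vK by (rule bij_betw_combine) auto
  have "adj G u v \<longleftrightarrow> adj (copies k (complete_graph 2)) (f u) (f v)"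
    if uv: "u \<in> verts G" "v \<in> verts G" for u v
  proof -
    have ginj: "g x = g y \<longleftrightarrow> x = y" if "x \<in> A" "y \<in> A" for x y
      using g that by (auto simp: bij_betw_def inj_on_def)
    have mem: "g x \<in> {1..k}" if "x \<in> A" for x using g that by (auto simp: bij_betw_def)
    have sA: "s x \<in> A" if "x \<in> B" for x using s that by (auto simp: bij_betw_def)
    consider "u \<in> A" "v \<in> A" | "u \<in> A" "v \<in> B" | "u \<in> B" "v \<in> A" | "u \<in> B" "v \<in> B"
      using uv V(1) by blast
    then show ?thesis
    proof cases
      case 1
      then have "\<not> adj G u v" using adj[OF uv] V(2) by blast
      with 1 show ?thesis by (simp add: adj_copies_complete_graph_2 fA doubleton_eq_iff)
    next
      case 2
      then have "adj G u v \<longleftrightarrow> u = s v" using adj[OF uv] V(2) by blast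
      with 2 ginj[of u "s v"] mem[of u] sA[of v] show ?thesis
        by (simp only: adj_copies_complete_graph_2 fA fB fst_conv snd_conv) auto
    next
      case 3
      then have "adj G u v \<longleftrightarrow> v = s u" using adj[OF uv] V(2) by blast
      with 3 ginj[of "s u" v] mem[of v] sA[of u] show ?thesis
        by (simp only: adj_copies_complete_graph_2 fA fB fst_conv snd_conv) auto
    next
      case 4
      then have "\<not> adj G u v" using adj[OF uv] V(2) by blast
      with 4 show ?thesis by (simp add: adj_copies_complete_graph_2 fB doubleton_eq_iff)
    qed
  qed
  with bij show ?thesis unfolding isomorphic_def by blast
qed

section \<open>Cycle decompositions of 2-regular graphs\<close>

text \<open>Only the edges need an argument. An endpoint \<open>u\<close> of an edge lies on some
  cycle of \<open>C\<close>, whose two cycle neighbours of \<open>u\<close> already exhaust its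
  degree 2. The other endpoint is therefore one of them, and the edge belongs to that cycle.\<close>

lemma consists_of_cycles_if_regular_2:
  assumes G: "simple_graph G" "finite (verts G)" "regular 2 G"
    and C: "\<And>p. p \<in> C \<Longrightarrow> is_cycle G p"
    and disj: "\<And>p q. p \<in> C \<Longrightarrow> q \<in> C \<Longrightarrow> p \<noteq> q \<Longrightarrow> set p \<inter> set q = {}"
    and cover: "verts G \<subseteq> (\<Union>p\<in>C. set p)"
  shows "consists_of_cycles G C"
proof -
  have "e \<in> (\<Union>p\<in>C. cyclic_edges p)" if e: "e \<in> edges G" for e
  proof -
    have "card e = 2" "e \<subseteq> verts G" using G(1) e by (auto simp: simple_graph_def)
    then obtain u v where uv: "e = {u, v}" "u \<in> verts G" "v \<in> verts G"
      by (auto simp: card_2_iff)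
    then obtain p where p: "p \<in> C" "u \<in> set p" using cover by blast
    then obtain k where k: "k < length p" "u = p ! k" by (auto simp: in_set_conv_nth)
    have cyc: "3 \<le> length p" "distinct p" "set p \<subseteq> verts G" "cyclic_edges p \<subseteq> edges G"
      using C[OF p(1)] by (auto simp: is_cycle_def)
    have "0 < length p" using cyc(1) by linarith
    define next_pos where "next_pos = Suc k mod length p"
    define prev_pos where "prev_pos = (if k = 0 then length p - 1 else k - 1)"
    have pos: "next_pos < length p" "prev_pos < length p" "Suc prev_pos mod length p = k"
      using k \<open>0 < length p\<close> by (auto simp: next_pos_def prev_pos_def)
    \<comment> \<open>Here length at least 3 matters: on a closed list of length 2 the two positions
      would coincide.\<close>
    have "next_pos \<noteq> prev_pos"
      using k cyc(1) by (auto simp: next_pos_def prev_pos_def mod_Suc)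
    then have neq: "p ! next_pos \<noteq> p ! prev_pos"
      using pos cyc(2) by (simp add: nth_eq_iff_index_eq)
    have next_edge: "{u, p ! next_pos} \<in> cyclic_edges p"
      using k by (auto simp: cyclic_edges_def next_pos_def)
    have prev_edge: "{u, p ! prev_pos} \<in> cyclic_edges p"
      using pos(2,3) k(2) by (auto simp: cyclic_edges_def insert_commute)
    let ?N = "{w \<in> verts G. adj G u w}"
    have "card ?N = 2" using G(3) uv by (simp add: regular_def degree_def)
    moreover have "{p ! next_pos, p ! prev_pos} \<subseteq> ?N"
      using next_edge prev_edge cyc pos by (auto simp: adj_def)
    ultimately have "{p ! next_pos, p ! prev_pos} = ?N"
      using G(2) neq by (intro card_subset_eq) auto
    moreover have "v \<in> ?N" using uv e by (simp add: adj_def)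
    ultimately have "v = p ! next_pos \<or> v = p ! prev_pos" by blast
    then show ?thesis using uv p next_edge prev_edge by blast
  qed
  then show ?thesis
    using C disj cover unfolding consists_of_cycles_def is_cycle_def by blast
qed

section \<open>The alternating cycles\<close>

lemma length_alternating_cycle [simp]: "length (alternating_cycle n m l i) = 2 * m"
  by (simp add: alternating_cycle_def)

text \<open>The inner reduction of \<open>k\<close> modulo \<open>m\<close> disappears under the
  outer one. In this form each position advances the second coordinate by \<open>m div 2\<close>
  modulo \<open>m\<close>, also halfway through the list, where the labels start over.\<close>

lemma nth_alternating_cycle:
  assumes "odd m" "k < 2 * m"
  shows "alternating_cycle n m (ecc_label m) i ! k =
    (if even k then i else n div 2 + i, (k * (m div 2)) mod m + 1)"
proof -
  have "(m - 1) div 2 = m div 2" using \<open>odd m\<close> by (auto elim!: oddE)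
  then show ?thesis
    using assms by (simp add: alternating_cycle_def ecc_label_def mod_mult_left_eq)
qed

text \<open>Without wrap-around the labels differ by \<open>m div 2\<close>; with wrap-around they
  differ by \<open>m div 2 + 1\<close>, and the complementary arc has length
  \<open>m div 2\<close>.\<close>

lemma cycle_dist_add_half_mod:
  assumes "odd m" "a < m"
  shows "cycle_dist m (a + 1) ((a + m div 2) mod m + 1) = m div 2"
proof -
  obtain h where h: "m = 2 * h + 1" using \<open>odd m\<close> by (elim oddE)
  show ?thesis
  proof (cases "a + h < m")
    case True
    then show ?thesis using h by (auto simp: cycle_dist_def)
  next
    case False
    then have "(a + h) mod m = a + h - m" using assms h by (simp add: mod_if)
    then show ?thesis using False assms h by (auto simp: cycle_dist_def)
  qed
qed

text \<open>Since \<open>m div 2\<close> is invertible modulo the odd number \<open>m\<close>, the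
  last hypothesis gives congruence of \<open>k\<close> and \<open>k'\<close> modulo
  \<open>m\<close>. Equal parity and coprimality of 2 and \<open>m\<close> raise this to congruence
  modulo \<open>2 * m\<close>, and both numbers lie below \<open>2 * m\<close>.\<close>

lemma mult_half_mod_inj:
  fixes k k' :: nat
  assumes "odd m" "k < 2 * m" "k' < 2 * m" "even k \<longleftrightarrow> even k'"
    and "(k * (m div 2)) mod m = (k' * (m div 2)) mod m"
  shows "k = k'"
proof -
  obtain h where h: "m = 2 * h + 1" using \<open>odd m\<close> by (elim oddE)
  have "int (k * h) mod int m = int (k' * h) mod int m"
  proof -
    have "m div 2 = h" using h by simp
    then have "(k * h) mod m = (k' * h) mod m" using assms(5) by (simp only:)
    then show ?thesis by (simp only: zmod_int[symmetric])
  qed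
  then have "int m dvd int k * int h - int k' * int h" by (simp add: mod_eq_dvd_iff)
  then have "int m dvd (int k - int k') * int h" by (simp add: algebra_simps)
  then have "int m dvd (int k - int k') * (2 * int h)" by (metis dvd_mult mult.left_commute)
  \<comment> \<open>\<open>2 * (m div 2)\<close> is \<open>-1\<close> modulo \<open>m\<close>.\<close>
  moreover have "(int k - int k') * int m - (int k - int k') * (2 * int h) = int k - int k'"
    using h by (simp add: algebra_simps)
  ultimately have "int m dvd int k - int k'" by (metis dvd_diff dvd_triv_right)
  moreover have "2 dvd int k - int k'" using assms(4) by simp
  moreover have "coprime 2 (int m)" using \<open>odd m\<close> by simp
  ultimately have "2 * int m dvd int k - int k'" by (simp add: divides_mult)
  then have "2 * int m \<le> \<bar>int k - int k'\<bar>" if "k \<noteq> k'"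
    using dvd_imp_le_int[of "int k - int k'" "2 * int m"] that by simp
  then show ?thesis using assms(2,3) by linarith
qed

text \<open>A vertex determines its position: the first coordinate reveals the parity, because
  \<open>n div 2\<close> is positive, and the second then fixes the position by
  \<open>mult_half_mod_inj\<close>.\<close>

lemma distinct_alternating_cycle:
  assumes "n \<ge> 2" "odd m"
  shows "distinct (alternating_cycle n m (ecc_label m) i)"
proof -
  have "k = k'" if k: "k < 2 * m" "k' < 2 * m"
    and eq: "alternating_cycle n m (ecc_label m) i ! k = alternating_cycle n m (ecc_label m) i ! k'"
  for k k'
  proof (rule mult_half_mod_inj[OF \<open>odd m\<close> k])
    show "even k \<longleftrightarrow> even k'"
      using eq assms k by (auto simp: nth_alternating_cycle split: if_splits)
    show "(k * (m div 2)) mod m = (k' * (m div 2)) mod m"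
      using eq assms k by (simp add: nth_alternating_cycle)
  qed
  then show ?thesis by (auto simp: distinct_conv_nth)
qed

lemma fst_alternating_cycle:
  "x \<in> set (alternating_cycle n m l i) \<Longrightarrow> fst x = i \<or> fst x = n div 2 + i"
  by (auto simp: alternating_cycle_def)

text \<open>The cycle with index \<open>i\<close> uses only the first coordinates \<open>i\<close>
  and \<open>n div 2 + i\<close>, and such pairs are disjoint for different indices up to
  \<open>n div 2\<close>.\<close>

lemma alternating_cycles_disjoint:
  assumes "i \<in> {1..n div 2}" "j \<in> {1..n div 2}" "i \<noteq> j"
  shows "set (alternating_cycle n m l i) \<inter> set (alternating_cycle n m l j) = {}"
proof -
  have False
    if "x \<in> set (alternating_cycle n m l i)" "x \<in> set (alternating_cycle n m l j)" for x
    using that[THEN fst_alternating_cycle] assms by auto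
  then show ?thesis by blast
qed

lemma set_alternating_cycle_subset:
  assumes "odd m" "i \<in> {1..n div 2}"
  shows "set (alternating_cycle n m (ecc_label m) i) \<subseteq> {1..n} \<times> {1..m}"
proof -
  have "0 < m" using \<open>odd m\<close> by (cases m) auto
  then show ?thesis
    using assms by (auto simp: alternating_cycle_def ecc_label_def Suc_le_eq)
qed

lemma is_cycle_alternating_cycle:
  assumes "n \<ge> 3" "m \<ge> 3" "even n" "odd m" and i: "i \<in> {1..n div 2}"
  shows "is_cycle (eccentric_graph (cycle_graph n \<box> cycle_graph m))
    (alternating_cycle n m (ecc_label m) i)"
proof -
  let ?p = "alternating_cycle n m (ecc_label m) i"
  note sub = set_alternating_cycle_subset[OF \<open>odd m\<close> i]
  have "adj (eccentric_graph (cycle_graph n \<box> cycle_graph m)) (?p ! k) (?p ! (Suc k mod (2 * m)))"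
    if k: "k < 2 * m" for k
  proof -
    let ?k = "Suc k mod (2 * m)"
    have k': "?k < 2 * m" using k by simp
    \<comment> \<open>Reduction modulo the even number \<open>2 * m\<close> preserves parity, so the
      first coordinate also alternates across the edge that closes the cycle.\<close>
    have par: "even ?k \<longleftrightarrow> odd k" by (simp add: dvd_mod_iff)
    \<comment> \<open>As \<open>m\<close> divides \<open>2 * m\<close>, the wrap-around at the
      closing edge is invisible modulo \<open>m\<close>.\<close>
    have "(?k * (m div 2)) mod m = (Suc k * (m div 2)) mod m"
      by (metis mod_mod_cancel dvd_triv_right mod_mult_left_eq)
    also have "\<dots> = (k * (m div 2) + m div 2) mod m" by (simp add: add.commute)
    also have "\<dots> = ((k * (m div 2)) mod m + m div 2) mod m"
      by (simp only: mod_add_left_eq)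
    finally have "cycle_dist m (snd (?p ! k)) (snd (?p ! ?k)) = m div 2"
      using cycle_dist_add_half_mod[OF \<open>odd m\<close>, of "(k * (m div 2)) mod m"] k k' \<open>odd m\<close>
      by (simp add: nth_alternating_cycle)
    moreover have "cycle_dist n (fst (?p ! k)) (fst (?p ! ?k)) = n div 2"
      using k k' par \<open>odd m\<close> \<open>even n\<close> by (auto simp: nth_alternating_cycle cycle_dist_def)
    moreover have "?p ! k \<in> {1..n} \<times> {1..m}" "?p ! ?k \<in> {1..n} \<times> {1..m}"
      by (intro subsetD[OF sub] nth_mem; use k k' in simp)+
    ultimately show ?thesis using adj_E assms by simp
  qed
  then show ?thesis
    using sub assms distinct_alternating_cycle[of n m i] verts_E[of n m]
    by (auto simp: is_cycle_def cyclic_edges_def adj_def simp del: atLeastAtMost_iff)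
qed

lemma consists_of_alternating_cycles:
  assumes "n \<ge> 3" "m \<ge> 3" "even n" "odd m"
  defines "C \<equiv> {alternating_cycle n m (ecc_label m) i |i. i \<in> {1..n div 2}}"
  shows "card C = n div 2"
    and "consists_of_cycles (eccentric_graph (cycle_graph n \<box> cycle_graph m)) C"
proof -
  let ?E = "eccentric_graph (cycle_graph n \<box> cycle_graph m)"
  let ?p = "alternating_cycle n m (ecc_label m)"
  have C: "C = ?p ` {1..n div 2}" by (auto simp: C_def)
  have V: "verts ?E = {1..n} \<times> {1..m}" using assms verts_E by simp
  \<comment> \<open>Nonemptiness lets disjointness of the vertex sets imply that different indices
    give different lists, which the count of the cycles requires.\<close>
  have ne: "set (?p i) \<noteq> {}" for i
    using assms by (metis length_alternating_cycle length_0_conv mult_eq_0_iff not_numeral_le_zero set_empty zero_neq_numeral)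
  have "inj_on ?p {1..n div 2}"
    by (rule inj_onI) (metis alternating_cycles_disjoint ne Int_absorb)
  then show "card C = n div 2" by (simp add: C card_image)
  have "card (\<Union>i\<in>{1..n div 2}. set (?p i)) = (\<Sum>i\<in>{1..n div 2}. card (set (?p i)))"
    by (intro card_UN_disjoint ballI impI alternating_cycles_disjoint) auto
  also have "\<dots> = n div 2 * (2 * m)"
    using assms by (simp add: distinct_card distinct_alternating_cycle)
  also have "\<dots> = card ({1..n} \<times> {1..m})"
    using \<open>even n\<close> by (simp add: card_cartesian_product)
  finally have "(\<Union>i\<in>{1..n div 2}. set (?p i)) = {1..n} \<times> {1..m}"
    using set_alternating_cycle_subset[OF \<open>odd m\<close>] by (intro card_subset_eq) blast+
  then have cover: "verts ?E \<subseteq> (\<Union>p\<in>C. set p)" by (simp add: V C)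
  show "consists_of_cycles ?E C"
  proof (rule consists_of_cycles_if_regular_2)
    show "regular 2 ?E" using assms regular_E_even_odd by simp
    show "is_cycle ?E p" if "p \<in> C" for p
      using that assms is_cycle_alternating_cycle by (auto simp: C simp del: atLeastAtMost_iff)
    show "set p \<inter> set q = {}" if "p \<in> C" "q \<in> C" "p \<noteq> q" for p q
      using that alternating_cycles_disjoint unfolding C by blast
  qed (use cover V simple_graph_eccentric_graph in auto)
qed

section \<open>The case of two even cycles, and the conclusion\<close>

lemma isomorphic_E_even_even:
  assumes "n \<ge> 3" "m \<ge> 3" "even n" "even m"
  shows "isomorphic (eccentric_graph (cycle_graph n \<box> cycle_graph m))
    (copies (n * m div 2) (complete_graph 2))"
proof -
  let ?E = "eccentric_graph (cycle_graph n \<box> cycle_graph m)"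
  obtain h where h: "n = 2 * h" using \<open>even n\<close> by (elim evenE)
  obtain l where l: "m = 2 * l" using \<open>even m\<close> by (elim evenE)
  \<comment> \<open>\<open>t\<close> is the antipodal map of the even cycle on
    \<open>{1..m}\<close>, and \<open>s\<close> the antipodal map of the product restricted to first
    coordinates above \<open>h\<close>.\<close>
  define t where "t y = (if y \<le> l then y + l else y - l)" for y
  define s where "s v = (fst v - h, t (snd v))" for v :: "nat \<times> nat"
  \<comment> \<open>Passing to the antipode in the first coordinate exchanges the halves
    \<open>{1..h}\<close> and \<open>{h + 1..n}\<close>, so each edge has one end in
    \<open>?A\<close> and one in \<open>?B\<close>.\<close>
  let ?A = "{1..h} \<times> {1..m}" and ?B = "{h + 1..n} \<times> {1..m}"
  have V: "verts ?E = {1..n} \<times> {1..m}" using assms verts_E by simp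
  show ?thesis
  proof (rule isomorphic_copies_complete_graph_2[where A = ?A and B = ?B and s = s])
    show "verts ?E = ?A \<union> ?B" using h V by auto
    show "card ?A = n * m div 2" using h by (simp add: card_cartesian_product)
    show "bij_betw s ?B ?A"
      \<comment> \<open>The inverse undoes the shift by \<open>h\<close> and applies
        \<open>t\<close> again, which is an involution on \<open>{1..m}\<close>.\<close>
      by (rule bij_betw_byWitness[where f' = "\<lambda>v. (fst v + h, t (snd v))"])
        (use h l in \<open>auto simp: s_def t_def\<close>)
    fix u v assume uv: "u \<in> verts ?E" "v \<in> verts ?E"
    have t: "cycle_dist m x y = m div 2 \<longleftrightarrow> y = t x" "t (t x) = x"
      if "x \<in> {1..m}" "y \<in> {1..m}" for x y
      using cycle_dist_eq_even_iff[OF \<open>even m\<close> that] that l by (auto simp: t_def)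
    have fst: "fst u \<in> {1..n}" "fst v \<in> {1..n}" and snd: "snd u \<in> {1..m}" "snd v \<in> {1..m}"
      using uv by (simp_all only: V mem_Times_iff)
    have "adj ?E u v \<longleftrightarrow> cycle_dist n (fst u) (fst v) = n div 2 \<and> cycle_dist m (snd u) (snd v) = m div 2"
      using uv adj_E[OF assms(1,2)] by (simp only: V simp_thms)
    also have "\<dots> \<longleftrightarrow> fst v = (if fst u \<le> h then fst u + h else fst u - h) \<and> snd v = t (snd u)"
      using cycle_dist_eq_even_iff[OF \<open>even n\<close> fst] t(1)[OF snd] h by simp
    finally have "adj ?E u v \<longleftrightarrow>
      fst v = (if fst u \<le> h then fst u + h else fst u - h) \<and> snd v = t (snd u)" .
    then show "adj ?E u v \<longleftrightarrow> u \<in> ?A \<and> v \<in> ?B \<and> u = s v \<or> u \<in> ?B \<and> v \<in> ?A \<and> v = s u"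
      using fst snd h t(2)[OF snd] t(2)[OF snd(2,1)] by (cases u; cases v) (auto simp: s_def)
  qed auto
qed

theorem mainTheorem9:
  fixes n m :: nat
  assumes "n \<ge> 3" and "m \<ge> 3"
  shows "(even n \<and> even m \<longrightarrow>
           (\<forall>v\<in>verts (eccentric_graph (cycle_graph n \<box> cycle_graph m)).
              degree (eccentric_graph (cycle_graph n \<box> cycle_graph m)) v = 1) \<and>
           isomorphic (eccentric_graph (cycle_graph n \<box> cycle_graph m))
             (copies (n * m div 2) (complete_graph 2))) \<and>
         (even n \<and> odd m \<longrightarrow>
           regular 2 (eccentric_graph (cycle_graph n \<box> cycle_graph m)) \<and>
           (\<exists>C. consists_of_cycles (eccentric_graph (cycle_graph n \<box> cycle_graph m)) C) \<and>
           (let C = {alternating_cycle n m (ecc_label m) i |i. i \<in> {1..n div 2}} in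
              card C = n div 2 \<and>
              (\<forall>p\<in>C. length p = 2 * m) \<and>
              consists_of_cycles (eccentric_graph (cycle_graph n \<box> cycle_graph m)) C))"
proof (intro conjI impI)
  assume "even n \<and> even m"
  then show "\<forall>v\<in>verts (eccentric_graph (cycle_graph n \<box> cycle_graph m)).
      degree (eccentric_graph (cycle_graph n \<box> cycle_graph m)) v = 1"
    and "isomorphic (eccentric_graph (cycle_graph n \<box> cycle_graph m))
      (copies (n * m div 2) (complete_graph 2))"
    using assms degree_E_even_even isomorphic_E_even_even by blast+
next
  assume "even n \<and> odd m"
  then have parity: "even n" "odd m" by auto
  note cycles = consists_of_alternating_cycles[OF assms parity]
  show "regular 2 (eccentric_graph (cycle_graph n \<box> cycle_graph m))"
    by (rule regular_E_even_odd[OF assms parity])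
  show "\<exists>C. consists_of_cycles (eccentric_graph (cycle_graph n \<box> cycle_graph m)) C"
    using cycles(2) by blast
  show "let C = {alternating_cycle n m (ecc_label m) i |i. i \<in> {1..n div 2}} in
      card C = n div 2 \<and> (\<forall>p\<in>C. length p = 2 * m) \<and>
      consists_of_cycles (eccentric_graph (cycle_graph n \<box> cycle_graph m)) C"
    unfolding Let_def using cycles by auto
qed

end
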